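(* Let $(P,\cdot,\{~,~\})$ be a Poisson algebra over a field $\mathbf{k}$ of characteristic $0$, let $(V,\mu,\rho)$ be a representation of it, and let $0\to V\xrightarrow{i}E\xrightarrow{p}P\to 0$ be an abelian extension of $P$ by the representation $(V,\mu,\rho)$. Then a pair $(\beta,\alpha)\in\mathrm{Aut}(V)\times\mathrm{Aut}(P)$ of Poisson algebra automorphisms is inducible if and only if $$(\beta,\alpha)\in\mathcal{C}_{\mu,\rho}\quad\text{and}\quad \mathcal{W}(\beta,\alpha)=0 .$$
   Context: A Poisson algebra $(P,\cdot,\{~,~\})$ is a commutative associative algebra $(P,\cdot)$ that is also a Lie algebra $(P,\{~,~\})$, with $\{x,y\cdot z\}=\{x,y\}\cdot z+y\cdot\{x,z\}$. A representation $(V,\mu,\rho)$ of it is a vector space $V$ with linear maps $\mu,\rho:P\to\mathrm{End}(V)$ such that for all $x,y\in P$: $\mu_{x\cdot y}=\mu_x\mu_y$, $\rho_{\{x,y\}}=\rho_x\rho_y-\rho_y\rho_x$, $\mu_{\{x,y\}}=\rho_x\mu_y-\mu_y\rho_x$, $\rho_{x\cdot y}=\mu_x\rho_y+\mu_y\rho_x$. An abelian extension of $P$ by $(V,\mu,\rho)$ is a short exact sequence of Poisson algebras $0\to V\xrightarrow{i}E\xrightarrow{p}P\to0$, where $V$ carries the trivial (zero) product and bracket, such that, identifying $V$ with $i(V)\subset E$, one has $\mu_xv=s(x)\cdot_Ev$ and $\rho_xv=\{s(x),v\}_E$ for $x\in P$, $v\in V$ and any linear section $s:P\to E$ of $p$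 (i.e. $ps=\mathrm{id}_P$). $\mathrm{Aut}$ denotes the group of Poisson algebra automorphisms; since $V$ has trivial structure, $\mathrm{Aut}(V)$ is the group of linear automorphisms of $V$. Inducible: $(\beta,\alpha)$ is inducible if there is a Poisson algebra automorphism $\gamma$ of $E$ with $\gamma(V)\subset V$, $\gamma|_V=\beta$ and $p\gamma s=\alpha$ (this does not depend on the linear section $s$). $\mathcal{C}_{\mu,\rho}$ is the set of $(\beta,\alpha)\in\mathrm{Aut}(V)\times\mathrm{Aut}(P)$ such that $\beta(\mu_xv)=\mu_{\alpha(x)}\beta(v)$ and $\beta(\rho_xv)=\rho_{\alpha(x)}\beta(v)$ for all $x\in P$, $v\in V$. Second (Flato-Gerstenhaber-Voronov) Poisson cohomology $H^2_{\mathrm{FGV}}(P,V)$: a Poisson $2$-cocycle is a pair $(h,H)$ with $h:P\times P\to V$ symmetric bilinear and $H:P\times P\to V$ skew-symmetric bilinear, satisfying for all $x,y,z\in P$ (1) $\mu_xh(y,z)-h(x\cdot y,z)+h(x,y\cdot z)-\mu_zh(x,y)=0$; (2) $\rho_xH(y,z)+\rho_yH(z,x)+\rho_zH(x,y)+H(x,\{y,z\})+H(y,\{z,x\})+H(z,\{x,y\})=0$; (3) $\rho_xh(y,z)-h(\{x,y\},z)-h(y,\{x,z\})+H(x,y\cdot z)-\mu_yH(x,z)-\mu_zH(x,y)=0$. Two $2$-cocycles $(h,H)$, $(h',H')$ are cohomologous if there is a linear map $\varphi:P\to V$ with $h(x,y)-h'(x,y)=\mu_x\varphi(y)-\varphi(x\cdot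 y)+\mu_y\varphi(x)$ and $H(x,y)-H'(x,y)=\rho_x\varphi(y)-\varphi(\{x,y\})-\rho_y\varphi(x)$. $H^2_{\mathrm{FGV}}(P,V)$ is the vector space of $2$-cocycles modulo this relation. Wells map: choose a linear section $s$ of $p$ and put $h(x,y)=s(x)\cdot_Es(y)-s(x\cdot y)$, $H(x,y)=\{s(x),s(y)\}_E-s(\{x,y\})$; $(h,H)$ is a Poisson $2$-cocycle. For $(\beta,\alpha)\in\mathcal{C}_{\mu,\rho}$ set $h_{(\beta,\alpha)}(x,y)=\beta(h(\alpha^{-1}(x),\alpha^{-1}(y)))$ and $H_{(\beta,\alpha)}(x,y)=\beta(H(\alpha^{-1}(x),\alpha^{-1}(y)))$; this is again a $2$-cocycle. Define $\mathcal{W}:\mathcal{C}_{\mu,\rho}\to H^2_{\mathrm{FGV}}(P,V)$ by $\mathcal{W}(\beta,\alpha)=[(h_{(\beta,\alpha)},H_{(\beta,\alpha)})-(h,H)]$; it does not depend on the choice of $s$. *)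

theory Defs
  imports Complex_Main "HOL-Library.Function_Algebras" "HOL-Library.Product_Plus"
begin

section \<open>Poisson algebras\<close>

text \<open>
  As in \<^locale>\<open>vector_space\<close>, the carrier of a vector space is a whole type, whose addition
  comes from the type class; scalar multiplication, product and bracket are explicit.
\<close>

record ('k, 'a) poisson =
  smult :: "'k \<Rightarrow> 'a \<Rightarrow> 'a"
  mult :: "'a \<Rightarrow> 'a \<Rightarrow> 'a"  (infixl "\<cdot>\<index>" 70)
  bracket :: "'a \<Rightarrow> 'a \<Rightarrow> 'a"  ("(\<lbrace>_,/ _\<rbrace>\<index>)")

definition bilinear_map ::
  "('k::field \<Rightarrow> 'a::ab_group_add \<Rightarrow> 'a) \<Rightarrow> ('k \<Rightarrow> 'b::ab_group_add \<Rightarrow> 'b) \<Rightarrow>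
   ('k \<Rightarrow> 'c::ab_group_add \<Rightarrow> 'c) \<Rightarrow> ('a \<Rightarrow> 'b \<Rightarrow> 'c) \<Rightarrow> bool" where
  "bilinear_map s1 s2 s3 f \<longleftrightarrow>
     (\<forall>x. Vector_Spaces.linear s2 s3 (f x)) \<and> (\<forall>y. Vector_Spaces.linear s1 s3 (\<lambda>x. f x y))"

locale poisson_algebra = vector_space "smult P"
  for P :: "('k::field_char_0, 'p::ab_group_add) poisson" (structure) +
  assumes mult_bilinear: "bilinear_map (smult P) (smult P) (smult P) (mult P)"
    and mult_assoc: "(x \<cdot> y) \<cdot> z = x \<cdot> (y \<cdot> z)"
    and mult_commute: "x \<cdot> y = y \<cdot> x"
    and bracket_bilinear: "bilinear_map (smult P) (smult P) (smult P) (bracket P)"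
    and bracket_self: "\<lbrace>x, x\<rbrace> = 0"
    and jacobi: "\<lbrace>x, \<lbrace>y, z\<rbrace>\<rbrace> + \<lbrace>y, \<lbrace>z, x\<rbrace>\<rbrace> + \<lbrace>z, \<lbrace>x, y\<rbrace>\<rbrace> = 0"
    and leibniz: "\<lbrace>x, y \<cdot> z\<rbrace> = \<lbrace>x, y\<rbrace> \<cdot> z + y \<cdot> \<lbrace>x, z\<rbrace>"

definition trivial_poisson :: "('k \<Rightarrow> 'v \<Rightarrow> 'v) \<Rightarrow> ('k, 'v::zero) poisson" where
  "trivial_poisson sV = \<lparr>smult = sV, mult = (\<lambda>_ _. 0), bracket = (\<lambda>_ _. 0)\<rparr>"

definition poisson_hom ::
  "('k::field, 'a::ab_group_add) poisson \<Rightarrow> ('k, 'b::ab_group_add) poisson \<Rightarrow> ('a \<Rightarrow> 'b) set" where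
  "poisson_hom A B = {f. Vector_Spaces.linear (smult A) (smult B) f \<and>
     (\<forall>x y. f (x \<cdot>\<^bsub>A\<^esub> y) = f x \<cdot>\<^bsub>B\<^esub> f y) \<and>
     (\<forall>x y. f \<lbrace>x, y\<rbrace>\<^bsub>A\<^esub> = \<lbrace>f x, f y\<rbrace>\<^bsub>B\<^esub>)}"

definition poisson_aut :: "('k::field, 'a::ab_group_add) poisson \<Rightarrow> ('a \<Rightarrow> 'a) set" where
  "poisson_aut A = {f \<in> poisson_hom A A. bij f}"


section \<open>Representations and abelian extensions\<close>

locale poisson_rep = poisson_algebra P + V: vector_space sV
  for P :: "('k::field_char_0, 'p::ab_group_add) poisson" (structure)
    and sV :: "'k \<Rightarrow> 'v::ab_group_add \<Rightarrow> 'v"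
    and \<mu> \<rho> :: "'p \<Rightarrow> 'v \<Rightarrow> 'v" +
  assumes mu_bilinear: "bilinear_map (smult P) sV sV \<mu>"
    and rho_bilinear: "bilinear_map (smult P) sV sV \<rho>"
    and mu_mult: "\<mu> (x \<cdot> y) v = \<mu> x (\<mu> y v)"
    and rho_bracket: "\<rho> \<lbrace>x, y\<rbrace> v = \<rho> x (\<rho> y v) - \<rho> y (\<rho> x v)"
    and mu_bracket: "\<mu> \<lbrace>x, y\<rbrace> v = \<rho> x (\<mu> y v) - \<mu> y (\<rho> x v)"
    and rho_mult: "\<rho> (x \<cdot> y) v = \<mu> x (\<rho> y v) + \<mu> y (\<rho> x v)"

definition linear_sections ::
  "('k::field, 'p::ab_group_add) poisson \<Rightarrow> ('k, 'e::ab_group_add) poisson \<Rightarrow> ('e \<Rightarrow> 'p) \<Rightarrow>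
   ('p \<Rightarrow> 'e) set" where
  "linear_sections P E p = {s. Vector_Spaces.linear (smult P) (smult E) s \<and> p \<circ> s = id}"

locale abelian_extension = poisson_rep P sV \<mu> \<rho> + E: poisson_algebra E
  for P :: "('k::field_char_0, 'p::ab_group_add) poisson"
    and sV :: "'k \<Rightarrow> 'v::ab_group_add \<Rightarrow> 'v"
    and \<mu> \<rho> :: "'p \<Rightarrow> 'v \<Rightarrow> 'v"
    and E :: "('k, 'e::ab_group_add) poisson"
    and i :: "'v \<Rightarrow> 'e" and p :: "'e \<Rightarrow> 'p" +
  assumes i_hom: "i \<in> poisson_hom (trivial_poisson sV) E"
    and p_hom: "p \<in> poisson_hom E P"
    and i_inj: "inj i"
    and exact: "range i = {e. p e = 0}"
    and p_surj: "surj p"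
    and mu_section: "s \<in> linear_sections P E p \<Longrightarrow> i (\<mu> x v) = s x \<cdot>\<^bsub>E\<^esub> i v"
    and rho_section: "s \<in> linear_sections P E p \<Longrightarrow> i (\<rho> x v) = \<lbrace>s x, i v\<rbrace>\<^bsub>E\<^esub>"


section \<open>Inducible and compatible pairs\<close>

text \<open>
  The condition \<open>p \<circ> \<gamma> \<circ> s = \<alpha>\<close> does not depend on the linear section \<open>s\<close>, and linear
  sections exist (lemmas \<open>inducible_iff_section\<close> and \<open>linear_sections_nonempty\<close> below).
\<close>

definition inducible ::
  "('k::field_char_0, 'p::ab_group_add) poisson \<Rightarrow> ('k, 'e::ab_group_add) poisson \<Rightarrow>
   ('v::ab_group_add \<Rightarrow> 'e) \<Rightarrow> ('e \<Rightarrow> 'p) \<Rightarrow> ('v \<Rightarrow> 'v) \<times> ('p \<Rightarrow> 'p) \<Rightarrow> bool" where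
  "inducible P E i p = (\<lambda>(\<beta>, \<alpha>). \<exists>\<gamma> \<in> poisson_aut E.
     \<gamma> ` range i \<subseteq> range i \<and> (\<forall>v. \<gamma> (i v) = i (\<beta> v)) \<and>
     (\<forall>s \<in> linear_sections P E p. p \<circ> \<gamma> \<circ> s = \<alpha>))"

definition compatible_pairs ::
  "('k::field_char_0, 'p::ab_group_add) poisson \<Rightarrow> ('k \<Rightarrow> 'v::ab_group_add \<Rightarrow> 'v) \<Rightarrow>
   ('p \<Rightarrow> 'v \<Rightarrow> 'v) \<Rightarrow> ('p \<Rightarrow> 'v \<Rightarrow> 'v) \<Rightarrow> (('v \<Rightarrow> 'v) \<times> ('p \<Rightarrow> 'p)) set" where
  "compatible_pairs P sV \<mu> \<rho> =
     {(\<beta>, \<alpha>). \<beta> \<in> poisson_aut (trivial_poisson sV) \<and> \<alpha> \<in> poisson_aut P \<and>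
       (\<forall>x v. \<beta> (\<mu> x v) = \<mu> (\<alpha> x) (\<beta> v)) \<and> (\<forall>x v. \<beta> (\<rho> x v) = \<rho> (\<alpha> x) (\<beta> v))}"


section \<open>The second Flato-Gerstenhaber-Voronov cohomology\<close>

type_synonym ('p, 'v) cochain2 = "('p \<Rightarrow> 'p \<Rightarrow> 'v) \<times> ('p \<Rightarrow> 'p \<Rightarrow> 'v)"

definition cocycles2 ::
  "('k::field_char_0, 'p::ab_group_add) poisson \<Rightarrow> ('k \<Rightarrow> 'v::ab_group_add \<Rightarrow> 'v) \<Rightarrow>
   ('p \<Rightarrow> 'v \<Rightarrow> 'v) \<Rightarrow> ('p \<Rightarrow> 'v \<Rightarrow> 'v) \<Rightarrow> ('p, 'v) cochain2 set" where
  "cocycles2 P sV \<mu> \<rho> = {(h, H).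
     bilinear_map (smult P) (smult P) sV h \<and> (\<forall>x y. h x y = h y x) \<and>
     bilinear_map (smult P) (smult P) sV H \<and> (\<forall>x y. H x y = - H y x) \<and>
     (\<forall>x y z. \<mu> x (h y z) - h (x \<cdot>\<^bsub>P\<^esub> y) z + h x (y \<cdot>\<^bsub>P\<^esub> z) - \<mu> z (h x y) = 0) \<and>
     (\<forall>x y z. \<rho> x (H y z) + \<rho> y (H z x) + \<rho> z (H x y)
        + H x \<lbrace>y, z\<rbrace>\<^bsub>P\<^esub> + H y \<lbrace>z, x\<rbrace>\<^bsub>P\<^esub> + H z \<lbrace>x, y\<rbrace>\<^bsub>P\<^esub> = 0) \<and>
     (\<forall>x y z. \<rho> x (h y z) - h \<lbrace>x, y\<rbrace>\<^bsub>P\<^esub> z - h y \<lbrace>x, z\<rbrace>\<^bsub>P\<^esub>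
        + H x (y \<cdot>\<^bsub>P\<^esub> z) - \<mu> y (H x z) - \<mu> z (H x y) = 0)}"

definition cohomologous ::
  "('k::field_char_0, 'p::ab_group_add) poisson \<Rightarrow> ('k \<Rightarrow> 'v::ab_group_add \<Rightarrow> 'v) \<Rightarrow>
   ('p \<Rightarrow> 'v \<Rightarrow> 'v) \<Rightarrow> ('p \<Rightarrow> 'v \<Rightarrow> 'v) \<Rightarrow> (('p, 'v) cochain2 \<times> ('p, 'v) cochain2) set" where
  "cohomologous P sV \<mu> \<rho> = {((h, H), (h', H')).
     (h, H) \<in> cocycles2 P sV \<mu> \<rho> \<and> (h', H') \<in> cocycles2 P sV \<mu> \<rho> \<and>
     (\<exists>\<phi>. Vector_Spaces.linear (smult P) sV \<phi> \<and>
       (\<forall>x y. h x y - h' x y = \<mu> x (\<phi> y) - \<phi> (x \<cdot>\<^bsub>P\<^esub> y) + \<mu> y (\<phi> x)) \<and>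
       (\<forall>x y. H x y - H' x y = \<rho> x (\<phi> y) - \<phi> \<lbrace>x, y\<rbrace>\<^bsub>P\<^esub> - \<rho> y (\<phi> x)))}"

definition cohomology_class ::
  "('k::field_char_0, 'p::ab_group_add) poisson \<Rightarrow> ('k \<Rightarrow> 'v::ab_group_add \<Rightarrow> 'v) \<Rightarrow>
   ('p \<Rightarrow> 'v \<Rightarrow> 'v) \<Rightarrow> ('p \<Rightarrow> 'v \<Rightarrow> 'v) \<Rightarrow> ('p, 'v) cochain2 \<Rightarrow> ('p, 'v) cochain2 set" where
  "cohomology_class P sV \<mu> \<rho> c = cohomologous P sV \<mu> \<rho> `` {c}"

definition H2_FGV ::
  "('k::field_char_0, 'p::ab_group_add) poisson \<Rightarrow> ('k \<Rightarrow> 'v::ab_group_add \<Rightarrow> 'v) \<Rightarrow>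
   ('p \<Rightarrow> 'v \<Rightarrow> 'v) \<Rightarrow> ('p \<Rightarrow> 'v \<Rightarrow> 'v) \<Rightarrow> ('p, 'v) cochain2 set set" where
  "H2_FGV P sV \<mu> \<rho> = cocycles2 P sV \<mu> \<rho> // cohomologous P sV \<mu> \<rho>"

definition H2_zero ::
  "('k::field_char_0, 'p::ab_group_add) poisson \<Rightarrow> ('k \<Rightarrow> 'v::ab_group_add \<Rightarrow> 'v) \<Rightarrow>
   ('p \<Rightarrow> 'v \<Rightarrow> 'v) \<Rightarrow> ('p \<Rightarrow> 'v \<Rightarrow> 'v) \<Rightarrow> ('p, 'v) cochain2 set" where
  "H2_zero P sV \<mu> \<rho> = cohomology_class P sV \<mu> \<rho> 0"


section \<open>The Wells map\<close>

text \<open>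
  The values \<open>s x \<cdot> s y - s (x \<cdot> y)\<close> and \<open>\<lbrace>s x, s y\<rbrace> - s \<lbrace>x, y\<rbrace>\<close> lie in the kernel of \<open>p\<close>,
  i.e. in the image of the injection \<open>i\<close>; \<open>inv i\<close> transports them back to \<open>V\<close>.
\<close>

definition section_cocycle ::
  "('k, 'p) poisson \<Rightarrow> ('k, 'e::ab_group_add) poisson \<Rightarrow> ('v \<Rightarrow> 'e) \<Rightarrow> ('p \<Rightarrow> 'e) \<Rightarrow>
   ('p, 'v) cochain2" where
  "section_cocycle P E i s =
     ((\<lambda>x y. inv i (s x \<cdot>\<^bsub>E\<^esub> s y - s (x \<cdot>\<^bsub>P\<^esub> y))),
      (\<lambda>x y. inv i (\<lbrace>s x, s y\<rbrace>\<^bsub>E\<^esub> - s \<lbrace>x, y\<rbrace>\<^bsub>P\<^esub>)))"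

definition twist :: "('v \<Rightarrow> 'v) \<times> ('p \<Rightarrow> 'p) \<Rightarrow> ('p, 'v) cochain2 \<Rightarrow> ('p, 'v) cochain2" where
  "twist = (\<lambda>(\<beta>, \<alpha>) (h, H).
     ((\<lambda>x y. \<beta> (h (inv \<alpha> x) (inv \<alpha> y))), (\<lambda>x y. \<beta> (H (inv \<alpha> x) (inv \<alpha> y)))))"

definition wells_wrt ::
  "('k::field_char_0, 'p::ab_group_add) poisson \<Rightarrow> ('k \<Rightarrow> 'v::ab_group_add \<Rightarrow> 'v) \<Rightarrow>
   ('p \<Rightarrow> 'v \<Rightarrow> 'v) \<Rightarrow> ('p \<Rightarrow> 'v \<Rightarrow> 'v) \<Rightarrow> ('k, 'e::ab_group_add) poisson \<Rightarrow>
   ('v \<Rightarrow> 'e) \<Rightarrow> ('p \<Rightarrow> 'e) \<Rightarrow> ('v \<Rightarrow> 'v) \<times> ('p \<Rightarrow> 'p) \<Rightarrow> ('p, 'v) cochain2 set" where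
  "wells_wrt P sV \<mu> \<rho> E i s ba =
     cohomology_class P sV \<mu> \<rho> (twist ba (section_cocycle P E i s) - section_cocycle P E i s)"

text \<open>
  On \<^const>\<open>compatible_pairs\<close> the value is a class in \<^const>\<open>H2_FGV\<close> which does not depend on
  the chosen section: see \<open>wells_wrt_in_H2\<close> and \<open>wells_map_eq\<close> below.
\<close>

definition wells_map ::
  "('k::field_char_0, 'p::ab_group_add) poisson \<Rightarrow> ('k \<Rightarrow> 'v::ab_group_add \<Rightarrow> 'v) \<Rightarrow>
   ('p \<Rightarrow> 'v \<Rightarrow> 'v) \<Rightarrow> ('p \<Rightarrow> 'v \<Rightarrow> 'v) \<Rightarrow> ('k, 'e::ab_group_add) poisson \<Rightarrow>
   ('v \<Rightarrow> 'e) \<Rightarrow> ('e \<Rightarrow> 'p) \<Rightarrow> ('v \<Rightarrow> 'v) \<times> ('p \<Rightarrow> 'p) \<Rightarrow> ('p, 'v) cochain2 set" where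
  "wells_map P sV \<mu> \<rho> E i p = wells_wrt P sV \<mu> \<rho> E i (SOME s. s \<in> linear_sections P E p)"


section \<open>Well-definedness\<close>

lemma bilinear_map_iff:
  assumes "vector_space s1" "vector_space s2" "vector_space s3"
  shows "bilinear_map s1 s2 s3 f \<longleftrightarrow>
    (\<forall>x y z. f x (y + z) = f x y + f x z) \<and> (\<forall>x y z. f (x + y) z = f x z + f y z) \<and>
    (\<forall>c x y. f x (s2 c y) = s3 c (f x y)) \<and> (\<forall>c x y. f (s1 c x) y = s3 c (f x y))"
  using assms unfolding bilinear_map_def Vector_Spaces.linear_iff by blast

lemma bilinear_mapD:
  assumes "bilinear_map s1 s2 s3 f"
  shows "f x (y + z) = f x y + f x z" "f (a + b) c = f a c + f b c"
    "f x (y - z) = f x y - f x z" "f (a - b) c = f a c - f b c"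
    "f x (- y) = - f x y" "f (- a) c = - f a c" "f x 0 = 0" "f 0 c = 0"
    "f x (s2 k y) = s3 k (f x y)" "f (s1 k a) c = s3 k (f a c)"
proof -
  have r: "Vector_Spaces.linear s2 s3 (f x)" for x
    using assms by (auto simp: bilinear_map_def)
  have l: "Vector_Spaces.linear s1 s3 (\<lambda>x. f x y)" for y
    using assms by (auto simp: bilinear_map_def)
  interpret r: Vector_Spaces.linear s2 s3 "f x" for x by (rule r)
  interpret l: Vector_Spaces.linear s1 s3 "\<lambda>x. f x y" for y by (rule l)
  show "f x (y + z) = f x y + f x z" by (rule r.add)
  show "f (a + b) c = f a c + f b c" by (rule l.add)
  show "f x (y - z) = f x y - f x z" by (rule r.diff)
  show "f (a - b) c = f a c - f b c" by (rule l.diff)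
  show "f x (- y) = - f x y" by (rule r.neg)
  show "f (- a) c = - f a c" by (rule l.neg)
  show "f x 0 = 0" by (rule r.zero)
  show "f 0 c = 0" by (rule l.zero)
  show "f x (s2 k y) = s3 k (f x y)" by (rule r.scale)
  show "f (s1 k a) c = s3 k (f a c)" by (rule l.scale)
qed

lemma linearD:
  assumes "Vector_Spaces.linear s1 s2 f"
  shows "f (x + y) = f x + f y" "f (x - y) = f x - f y" "f (- x) = - f x" "f 0 = 0"
    "f (s1 k x) = s2 k (f x)"
proof -
  interpret Vector_Spaces.linear s1 s2 f by (rule assms)
  show "f (x + y) = f x + f y" "f (x - y) = f x - f y" "f (- x) = - f x" "f 0 = 0"
    "f (s1 k x) = s2 k (f x)" by (rule add diff neg zero scale)+
qed

lemma (in poisson_algebra) bracket_skew: "\<lbrace>x, y\<rbrace> = - \<lbrace>y, x\<rbrace>"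
proof -
  have "\<lbrace>x + y, x + y\<rbrace> = \<lbrace>x, y\<rbrace> + \<lbrace>y, x\<rbrace>"
    by (simp add: bilinear_mapD(1,2)[OF bracket_bilinear] bracket_self[of x] bracket_self[of y]
        add.commute)
  then show ?thesis by (simp add: bracket_self eq_neg_iff_add_eq_0)
qed

context abelian_extension
begin

lemmas bl = bilinear_mapD[OF E.mult_bilinear] bilinear_mapD[OF E.bracket_bilinear]
  bilinear_mapD[OF mult_bilinear] bilinear_mapD[OF bracket_bilinear]
  bilinear_mapD[OF mu_bilinear] bilinear_mapD[OF rho_bilinear]

lemma i_linear: "Vector_Spaces.linear sV (smult E) i"
  using i_hom by (simp add: poisson_hom_def trivial_poisson_def)

lemma i_zero_ops: "i v \<cdot>\<^bsub>E\<^esub> i w = 0" "\<lbrace>i v, i w\<rbrace>\<^bsub>E\<^esub> = 0"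
  using i_hom linearD(4)[OF i_linear] by (simp_all add: poisson_hom_def trivial_poisson_def)

lemma p_linear: "Vector_Spaces.linear (smult E) (smult P) p"
  and p_mult: "p (x \<cdot>\<^bsub>E\<^esub> y) = p x \<cdot>\<^bsub>P\<^esub> p y"
  and p_bracket: "p \<lbrace>x, y\<rbrace>\<^bsub>E\<^esub> = \<lbrace>p x, p y\<rbrace>\<^bsub>P\<^esub>"
  using p_hom by (simp_all add: poisson_hom_def)

lemma i_inv: "p e = 0 \<Longrightarrow> i (inv i e) = e"
  using exact by (metis (mono_tags) f_inv_into_f mem_Collect_eq)

lemma linear_sections_nonempty: "linear_sections P E p \<noteq> {}"
proof -
  interpret vector_space_pair "smult E" "smult P" ..
  show ?thesis
    using linear_surjective_right_inverse[OF p_linear p_surj] by (auto simp: linear_sections_def)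
qed

lemma section_linear: "s \<in> linear_sections P E p \<Longrightarrow> Vector_Spaces.linear (smult P) (smult E) s"
  and section_p: "s \<in> linear_sections P E p \<Longrightarrow> p (s x) = x"
  by (auto simp: linear_sections_def fun_eq_iff)

lemma inducible_iff_section:
  assumes s: "s \<in> linear_sections P E p"
  shows "inducible P E i p (\<beta>, \<alpha>) \<longleftrightarrow> (\<exists>\<gamma> \<in> poisson_aut E. \<gamma> ` range i \<subseteq> range i \<and>
    (\<forall>v. \<gamma> (i v) = i (\<beta> v)) \<and> p \<circ> \<gamma> \<circ> s = \<alpha>)"
proof -
  have indep: "p \<circ> \<gamma> \<circ> t = p \<circ> \<gamma> \<circ> s"
    if g: "\<gamma> \<in> poisson_aut E" "\<gamma> ` range i \<subseteq> range i" and t: "t \<in> linear_sections P E p" for \<gamma> t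
  proof
    fix x
    have gl: "Vector_Spaces.linear (smult E) (smult E) \<gamma>"
      using g by (simp add: poisson_aut_def poisson_hom_def)
    have "t x - s x \<in> range i"
      unfolding exact by (simp add: linearD[OF p_linear] section_p[OF s] section_p[OF t])
    then have "p (\<gamma> (t x - s x)) = 0" using g(2) exact by blast
    then show "(p \<circ> \<gamma> \<circ> t) x = (p \<circ> \<gamma> \<circ> s) x"
      by (simp add: linearD[OF p_linear] linearD[OF gl])
  qed
  show ?thesis (is "?L \<longleftrightarrow> ?R")
  proof
    assume ?L
    then show ?R using s unfolding inducible_def by blast
  next
    assume ?R
    then obtain \<gamma> where g: "\<gamma> \<in> poisson_aut E" "\<gamma> ` range i \<subseteq> range i"
      "\<forall>v. \<gamma> (i v) = i (\<beta> v)" "p \<circ> \<gamma> \<circ> s = \<alpha>" by blast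
    have "\<forall>t \<in> linear_sections P E p. p \<circ> \<gamma> \<circ> t = \<alpha>"
      using indep[OF g(1,2)] g(4) by simp
    then show ?L unfolding inducible_def using g(1-3) by blast
  qed
qed

lemma i_section_cocycle:
  assumes s: "s \<in> linear_sections P E p" and c: "section_cocycle P E i s = (h, H)"
  shows "i (h x y) = s x \<cdot>\<^bsub>E\<^esub> s y - s (x \<cdot>\<^bsub>P\<^esub> y)"
    "i (H x y) = \<lbrace>s x, s y\<rbrace>\<^bsub>E\<^esub> - s \<lbrace>x, y\<rbrace>\<^bsub>P\<^esub>"
  using c unfolding section_cocycle_def
  by (auto intro!: i_inv simp: linearD[OF p_linear] section_p[OF s] p_mult p_bracket)

lemma section_cocycle_in:
  assumes s: "s \<in> linear_sections P E p"
  shows "section_cocycle P E i s \<in> cocycles2 P sV \<mu> \<rho>"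
proof -
  obtain h H where c: "section_cocycle P E i s = (h, H)" by fastforce
  note hH = i_section_cocycle[OF s c]
  note sl = linearD[OF section_linear[OF s]]
  note il = linearD[OF i_linear]
  note ms = mu_section[OF s] and rs = rho_section[OF s]
  note vs = vector_space_axioms V.vector_space_axioms
  note inji = injD[OF i_inj]
  have Ecomm: "(u \<cdot>\<^bsub>E\<^esub> v) \<cdot>\<^bsub>E\<^esub> w = w \<cdot>\<^bsub>E\<^esub> (u \<cdot>\<^bsub>E\<^esub> v)" for u v w by (rule E.mult_commute)
  have "bilinear_map (smult P) (smult P) sV h"
    unfolding bilinear_map_iff[OF vs(1,1,2)]
    by (intro conjI allI inji) (simp_all add: hH il sl bl E.scale_right_diff_distrib)
  moreover have "bilinear_map (smult P) (smult P) sV H"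
    unfolding bilinear_map_iff[OF vs(1,1,2)]
    by (intro conjI allI inji) (simp_all add: hH il sl bl E.scale_right_diff_distrib)
  moreover have "h x y = h y x" for x y
    by (rule inji) (simp add: hH mult_commute E.mult_commute)
  moreover have "H x y = - H y x" for x y
    by (rule inji) (simp add: hH il bracket_skew[of x] E.bracket_skew[of "s x"] sl)
  moreover have "\<mu> x (h y z) - h (x \<cdot>\<^bsub>P\<^esub> y) z + h x (y \<cdot>\<^bsub>P\<^esub> z) - \<mu> z (h x y) = 0" for x y z
    by (rule inji)
      (simp add: hH il ms bl sl mult_assoc E.mult_assoc[symmetric] Ecomm[of "s x" "s y" "s z"]
        E.mult_commute[of "s z" "s (x \<cdot>\<^bsub>P\<^esub> y)"])
  moreover have "\<rho> x (H y z) + \<rho> y (H z x) + \<rho> z (H x y)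
        + H x \<lbrace>y, z\<rbrace>\<^bsub>P\<^esub> + H y \<lbrace>z, x\<rbrace>\<^bsub>P\<^esub> + H z \<lbrace>x, y\<rbrace>\<^bsub>P\<^esub> = 0" for x y z
  proof (rule inji)
    have J: "s \<lbrace>x, \<lbrace>y, z\<rbrace>\<^bsub>P\<^esub>\<rbrace>\<^bsub>P\<^esub> + s \<lbrace>y, \<lbrace>z, x\<rbrace>\<^bsub>P\<^esub>\<rbrace>\<^bsub>P\<^esub> + s \<lbrace>z, \<lbrace>x, y\<rbrace>\<^bsub>P\<^esub>\<rbrace>\<^bsub>P\<^esub> = 0"
      using jacobi[of x y z] by (simp flip: sl(1) add: sl(4))
    show "i (\<rho> x (H y z) + \<rho> y (H z x) + \<rho> z (H x y)
        + H x \<lbrace>y, z\<rbrace>\<^bsub>P\<^esub> + H y \<lbrace>z, x\<rbrace>\<^bsub>P\<^esub> + H z \<lbrace>x, y\<rbrace>\<^bsub>P\<^esub>) = i 0"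
      using J E.jacobi[of "s x" "s y" "s z"]
      by (simp add: hH il rs bl) (simp add: algebra_simps neg_eq_iff_add_eq_0)
  qed
  moreover have "\<rho> x (h y z) - h \<lbrace>x, y\<rbrace>\<^bsub>P\<^esub> z - h y \<lbrace>x, z\<rbrace>\<^bsub>P\<^esub>
        + H x (y \<cdot>\<^bsub>P\<^esub> z) - \<mu> y (H x z) - \<mu> z (H x y) = 0" for x y z
    by (rule inji)
      (simp add: hH il rs ms bl sl leibniz E.leibniz
        E.mult_commute[of "\<lbrace>s x, s y\<rbrace>\<^bsub>E\<^esub>" "s z"]
        E.mult_commute[of "s \<lbrace>x, y\<rbrace>\<^bsub>P\<^esub>" "s z"])
  ultimately show ?thesis unfolding c cocycles2_def mem_Collect_eq prod.case by blast
qed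

lemma cocycles2_diff:
  assumes "c \<in> cocycles2 P sV \<mu> \<rho>" "d \<in> cocycles2 P sV \<mu> \<rho>"
  shows "c - d \<in> cocycles2 P sV \<mu> \<rho>"
proof -
  obtain h H h' H' where cd: "c = (h, H)" "d = (h', H')" by fastforce
  note vs = vector_space_axioms V.vector_space_axioms
  have bd: "bilinear_map (smult P) (smult P) sV (f - g)"
    if "bilinear_map (smult P) (smult P) sV f" "bilinear_map (smult P) (smult P) sV g" for f g
    using that unfolding bilinear_map_iff[OF vs(1,1,2)]
    by (simp add: V.scale_right_diff_distrib)
  have a: "bilinear_map (smult P) (smult P) sV h" "h x y = h y x"
     "bilinear_map (smult P) (smult P) sV H" "H x y = - H y x"
     "\<mu> x (h y z) - h (x \<cdot>\<^bsub>P\<^esub> y) z + h x (y \<cdot>\<^bsub>P\<^esub> z) - \<mu> z (h x y) = 0"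
     "\<rho> x (H y z) + \<rho> y (H z x) + \<rho> z (H x y)
        + H x \<lbrace>y, z\<rbrace>\<^bsub>P\<^esub> + H y \<lbrace>z, x\<rbrace>\<^bsub>P\<^esub> + H z \<lbrace>x, y\<rbrace>\<^bsub>P\<^esub> = 0"
     "\<rho> x (h y z) - h \<lbrace>x, y\<rbrace>\<^bsub>P\<^esub> z - h y \<lbrace>x, z\<rbrace>\<^bsub>P\<^esub>
        + H x (y \<cdot>\<^bsub>P\<^esub> z) - \<mu> y (H x z) - \<mu> z (H x y) = 0" for x y z
    using assms(1) unfolding cd cocycles2_def by blast+
  have b: "bilinear_map (smult P) (smult P) sV h'" "h' x y = h' y x"
     "bilinear_map (smult P) (smult P) sV H'" "H' x y = - H' y x"
     "\<mu> x (h' y z) - h' (x \<cdot>\<^bsub>P\<^esub> y) z + h' x (y \<cdot>\<^bsub>P\<^esub> z) - \<mu> z (h' x y) = 0"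
     "\<rho> x (H' y z) + \<rho> y (H' z x) + \<rho> z (H' x y)
        + H' x \<lbrace>y, z\<rbrace>\<^bsub>P\<^esub> + H' y \<lbrace>z, x\<rbrace>\<^bsub>P\<^esub> + H' z \<lbrace>x, y\<rbrace>\<^bsub>P\<^esub> = 0"
     "\<rho> x (h' y z) - h' \<lbrace>x, y\<rbrace>\<^bsub>P\<^esub> z - h' y \<lbrace>x, z\<rbrace>\<^bsub>P\<^esub>
        + H' x (y \<cdot>\<^bsub>P\<^esub> z) - \<mu> y (H' x z) - \<mu> z (H' x y) = 0" for x y z
    using assms(2) unfolding cd cocycles2_def by blast+
  show ?thesis unfolding cd cocycles2_def
  proof (clarsimp simp: bl, intro conjI allI, goal_cases)
    case 1 show ?case by (rule bd[OF a(1) b(1)])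
  next
    case (2 x y) show ?case by (rule arg_cong2[OF a(2) b(2)])
  next
    case 3 show ?case by (rule bd[OF a(3) b(3)])
  next
    case (4 x y) show ?case using a(4)[of x y] b(4)[of x y] by simp
  next
    case (5 x y z) show ?case using arg_cong2[OF a(5)[of x y z] b(5)[of x y z], of minus]
      by (simp add: algebra_simps)
  next
    case (6 x y z) show ?case using arg_cong2[OF a(6)[of x y z] b(6)[of x y z], of minus]
      by (simp add: algebra_simps)
  next
    case (7 x y z) show ?case using arg_cong2[OF a(7)[of x y z] b(7)[of x y z], of minus]
      by (simp add: algebra_simps)
  qed
qed

lemma twist_in:
  assumes ba: "ba \<in> compatible_pairs P sV \<mu> \<rho>" and c: "c \<in> cocycles2 P sV \<mu> \<rho>"
  shows "twist ba c \<in> cocycles2 P sV \<mu> \<rho>"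
proof -
  obtain \<beta> \<alpha> where ba': "ba = (\<beta>, \<alpha>)" by fastforce
  obtain h H where c': "c = (h, H)" by fastforce
  let ?a = "inv \<alpha>"
  have al: "Vector_Spaces.linear (smult P) (smult P) \<alpha>" "\<alpha> (x \<cdot>\<^bsub>P\<^esub> y) = \<alpha> x \<cdot>\<^bsub>P\<^esub> \<alpha> y"
    "\<alpha> \<lbrace>x, y\<rbrace>\<^bsub>P\<^esub> = \<lbrace>\<alpha> x, \<alpha> y\<rbrace>\<^bsub>P\<^esub>" and abij: "bij \<alpha>" for x y
    using ba by (auto simp: ba' compatible_pairs_def poisson_aut_def poisson_hom_def)
  have bl': "Vector_Spaces.linear sV sV \<beta>"
    and bm: "\<beta> (\<mu> x v) = \<mu> (\<alpha> x) (\<beta> v)" and br: "\<beta> (\<rho> x v) = \<rho> (\<alpha> x) (\<beta> v)" for x v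
    using ba by (auto simp: ba' compatible_pairs_def poisson_aut_def poisson_hom_def trivial_poisson_def)
  note b = linearD[OF bl']
  have aa: "\<alpha> (?a x) = x" for x using abij by (simp add: bij_is_surj surj_f_inv_f)
  have ai: "?a x = y \<longleftrightarrow> x = \<alpha> y" for x y
    using bij_inv_eq_iff[OF abij, of y x] by auto
  have i: "?a (x + y) = ?a x + ?a y" "?a (smult P k x) = smult P k (?a x)"
    "?a (x \<cdot>\<^bsub>P\<^esub> y) = ?a x \<cdot>\<^bsub>P\<^esub> ?a y" "?a \<lbrace>x, y\<rbrace>\<^bsub>P\<^esub> = \<lbrace>?a x, ?a y\<rbrace>\<^bsub>P\<^esub>" for x y k
    by (simp_all add: ai al(2,3) linearD[OF al(1)] aa)
  have m: "\<mu> x (\<beta> v) = \<beta> (\<mu> (?a x) v)" "\<rho> x (\<beta> v) = \<beta> (\<rho> (?a x) v)" for x v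
    by (simp_all add: bm br aa)
  note vs = vector_space_axioms V.vector_space_axioms
  have bd: "bilinear_map (smult P) (smult P) sV (\<lambda>x y. \<beta> (f (?a x) (?a y)))"
    if "bilinear_map (smult P) (smult P) sV f" for f
    using that unfolding bilinear_map_iff[OF vs(1,1,2)] by (simp add: i b)
  have a: "bilinear_map (smult P) (smult P) sV h" "h x y = h y x"
     "bilinear_map (smult P) (smult P) sV H" "H x y = - H y x"
     "\<mu> x (h y z) - h (x \<cdot>\<^bsub>P\<^esub> y) z + h x (y \<cdot>\<^bsub>P\<^esub> z) - \<mu> z (h x y) = 0"
     "\<rho> x (H y z) + \<rho> y (H z x) + \<rho> z (H x y)
        + H x \<lbrace>y, z\<rbrace>\<^bsub>P\<^esub> + H y \<lbrace>z, x\<rbrace>\<^bsub>P\<^esub> + H z \<lbrace>x, y\<rbrace>\<^bsub>P\<^esub> = 0"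
     "\<rho> x (h y z) - h \<lbrace>x, y\<rbrace>\<^bsub>P\<^esub> z - h y \<lbrace>x, z\<rbrace>\<^bsub>P\<^esub>
        + H x (y \<cdot>\<^bsub>P\<^esub> z) - \<mu> y (H x z) - \<mu> z (H x y) = 0" for x y z
    using c unfolding c' cocycles2_def by blast+
  show ?thesis unfolding c' ba' cocycles2_def twist_def
  proof (clarsimp simp: m i simp flip: b(1,2), intro conjI allI, goal_cases)
    case 1 show ?case by (rule bd[OF a(1)])
  next
    case (2 x y) show ?case by (rule arg_cong[OF a(2)])
  next
    case 3 show ?case by (rule bd[OF a(3)])
  next
    case (4 x y) show ?case by (subst a(4)) (simp only: b(3))
  qed (simp_all add: a(6) a(5,7)[THEN eq_iff_diff_eq_0[THEN iffD2]] b(4))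
qed

lemma zero_cocycle: "0 \<in> cocycles2 P sV \<mu> \<rho>"
  using cocycles2_diff section_cocycle_in linear_sections_nonempty
  by (metis all_not_in_conv cancel_comm_monoid_add_class.diff_cancel)

lemma equiv_cohomologous: "equiv (cocycles2 P sV \<mu> \<rho>) (cohomologous P sV \<mu> \<rho>)"
proof -
  let ?Z = "cocycles2 P sV \<mu> \<rho>" and ?R = "cohomologous P sV \<mu> \<rho>"
  interpret PV: vector_space_pair "smult P" sV ..
  have "?R \<subseteq> ?Z \<times> ?Z" by (auto simp: cohomologous_def)
  moreover have "refl_on ?Z ?R"
  proof (rule refl_onI)
    fix c assume "c \<in> ?Z"
    then show "(c, c) \<in> ?R"
      by (auto simp: cohomologous_def bl intro!: exI[of _ "\<lambda>_. 0"] PV.linear_zero)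
  qed
  moreover have "sym ?R"
  proof (rule symI)
    fix c d assume "(c, d) \<in> ?R"
    then obtain h H h' H' \<phi> where
      *: "c = (h, H)" "d = (h', H')" "(h, H) \<in> ?Z" "(h', H') \<in> ?Z"
      "Vector_Spaces.linear (smult P) sV \<phi>"
      "\<And>x y. h x y - h' x y = \<mu> x (\<phi> y) - \<phi> (x \<cdot>\<^bsub>P\<^esub> y) + \<mu> y (\<phi> x)"
      "\<And>x y. H x y - H' x y = \<rho> x (\<phi> y) - \<phi> \<lbrace>x, y\<rbrace>\<^bsub>P\<^esub> - \<rho> y (\<phi> x)"
      by (auto simp: cohomologous_def)
    have "h' x y - h x y = \<mu> x (- \<phi> y) - (- \<phi> (x \<cdot>\<^bsub>P\<^esub> y)) + \<mu> y (- \<phi> x)"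
      "H' x y - H x y = \<rho> x (- \<phi> y) - (- \<phi> \<lbrace>x, y\<rbrace>\<^bsub>P\<^esub>) - \<rho> y (- \<phi> x)" for x y
      using *(6)[of x y] *(7)[of x y] by (simp_all add: bl algebra_simps)
    then show "(d, c) \<in> ?R" using * PV.linear_compose_neg[OF *(5)]
      by (auto simp: cohomologous_def intro!: exI[of _ "\<lambda>x. - \<phi> x"])
  qed
  moreover have "trans ?R"
  proof (rule transI)
    fix c d e assume "(c, d) \<in> ?R" "(d, e) \<in> ?R"
    then obtain h H h' H' h'' H'' \<phi> \<psi> where
      *: "c = (h, H)" "d = (h', H')" "e = (h'', H'')" "(h, H) \<in> ?Z" "(h'', H'') \<in> ?Z"
      "Vector_Spaces.linear (smult P) sV \<phi>"
      "\<And>x y. h x y - h' x y = \<mu> x (\<phi> y) - \<phi> (x \<cdot>\<^bsub>P\<^esub> y) + \<mu> y (\<phi> x)"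
      "\<And>x y. H x y - H' x y = \<rho> x (\<phi> y) - \<phi> \<lbrace>x, y\<rbrace>\<^bsub>P\<^esub> - \<rho> y (\<phi> x)"
      "Vector_Spaces.linear (smult P) sV \<psi>"
      "\<And>x y. h' x y - h'' x y = \<mu> x (\<psi> y) - \<psi> (x \<cdot>\<^bsub>P\<^esub> y) + \<mu> y (\<psi> x)"
      "\<And>x y. H' x y - H'' x y = \<rho> x (\<psi> y) - \<psi> \<lbrace>x, y\<rbrace>\<^bsub>P\<^esub> - \<rho> y (\<psi> x)"
      by (auto simp: cohomologous_def)
    have "h x y - h'' x y = \<mu> x (\<phi> y + \<psi> y) - (\<phi> (x \<cdot>\<^bsub>P\<^esub> y) + \<psi> (x \<cdot>\<^bsub>P\<^esub> y)) + \<mu> y (\<phi> x + \<psi> x)"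
      "H x y - H'' x y = \<rho> x (\<phi> y + \<psi> y) - (\<phi> \<lbrace>x, y\<rbrace>\<^bsub>P\<^esub> + \<psi> \<lbrace>x, y\<rbrace>\<^bsub>P\<^esub>) - \<rho> y (\<phi> x + \<psi> x)" for x y
      using arg_cong2[OF *(7)[of x y] *(10)[of x y], of plus]
        arg_cong2[OF *(8)[of x y] *(11)[of x y], of plus] by (simp_all add: bl algebra_simps)
    then show "(c, e) \<in> ?R" using * PV.linear_compose_add[OF *(6,9)]
      by (auto simp: cohomologous_def intro!: exI[of _ "\<lambda>x. \<phi> x + \<psi> x"])
  qed
  ultimately show ?thesis by (rule equivI)
qed

lemma H2_zero_in: "H2_zero P sV \<mu> \<rho> \<in> H2_FGV P sV \<mu> \<rho>"
  unfolding H2_zero_def H2_FGV_def cohomology_class_def by (rule quotientI) (rule zero_cocycle)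

lemma wells_wrt_in_H2:
  assumes "s \<in> linear_sections P E p" "ba \<in> compatible_pairs P sV \<mu> \<rho>"
  shows "wells_wrt P sV \<mu> \<rho> E i s ba \<in> H2_FGV P sV \<mu> \<rho>"
  unfolding wells_wrt_def H2_FGV_def cohomology_class_def
  by (intro quotientI cocycles2_diff twist_in section_cocycle_in assms)

lemma wells_wrt_cong:
  assumes s: "s \<in> linear_sections P E p" and t: "t \<in> linear_sections P E p"
    and ba: "ba \<in> compatible_pairs P sV \<mu> \<rho>"
  shows "wells_wrt P sV \<mu> \<rho> E i s ba = wells_wrt P sV \<mu> \<rho> E i t ba"
proof -
  interpret PV: vector_space_pair "smult P" sV ..
  obtain \<beta> \<alpha> where ba': "ba = (\<beta>, \<alpha>)" by fastforce
  let ?a = "inv \<alpha>"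
  have al: "Vector_Spaces.linear (smult P) (smult P) \<alpha>" "\<alpha> (x \<cdot>\<^bsub>P\<^esub> y) = \<alpha> x \<cdot>\<^bsub>P\<^esub> \<alpha> y"
    "\<alpha> \<lbrace>x, y\<rbrace>\<^bsub>P\<^esub> = \<lbrace>\<alpha> x, \<alpha> y\<rbrace>\<^bsub>P\<^esub>" and abij: "bij \<alpha>" for x y
    using ba by (auto simp: ba' compatible_pairs_def poisson_aut_def poisson_hom_def)
  have bl': "Vector_Spaces.linear sV sV \<beta>"
    and bm: "\<beta> (\<mu> x v) = \<mu> (\<alpha> x) (\<beta> v)" and br: "\<beta> (\<rho> x v) = \<rho> (\<alpha> x) (\<beta> v)" for x v
    using ba by (auto simp: ba' compatible_pairs_def poisson_aut_def poisson_hom_def trivial_poisson_def)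
  note b = linearD[OF bl']
  have aa: "\<alpha> (?a x) = x" for x using abij by (simp add: bij_is_surj surj_f_inv_f)
  have ai: "?a x = y \<longleftrightarrow> x = \<alpha> y" for x y
    using bij_inv_eq_iff[OF abij, of y x] by auto
  have ia: "?a (x + y) = ?a x + ?a y" "?a (smult P k x) = smult P k (?a x)"
    "?a (x \<cdot>\<^bsub>P\<^esub> y) = ?a x \<cdot>\<^bsub>P\<^esub> ?a y" "?a \<lbrace>x, y\<rbrace>\<^bsub>P\<^esub> = \<lbrace>?a x, ?a y\<rbrace>\<^bsub>P\<^esub>" for x y k
    by (simp_all add: ai al(2,3) linearD[OF al(1)] aa)
  obtain h H where c: "section_cocycle P E i s = (h, H)" by fastforce
  obtain h' H' where c': "section_cocycle P E i t = (h', H')" by fastforce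
  note hH = i_section_cocycle[OF s c] i_section_cocycle[OF t c']
  note il = linearD[OF i_linear]
  note inji = injD[OF i_inj]
  note sl = linearD[OF section_linear[OF s]] linearD[OF section_linear[OF t]]
  define \<phi> where "\<phi> = (\<lambda>x. inv i (s x - t x))"
  have i\<phi>: "i (\<phi> x) = s x - t x" for x
    unfolding \<phi>_def by (rule i_inv) (simp add: linearD[OF p_linear] section_p[OF s] section_p[OF t])
  have \<phi>l: "Vector_Spaces.linear (smult P) sV \<phi>"
    unfolding Vector_Spaces.linear_iff
    by (intro conjI allI vector_space_axioms V.vector_space_axioms inji)
      (simp_all add: i\<phi> il sl E.scale_right_diff_distrib)
  have d: "h x y - h' x y = \<mu> x (\<phi> y) - \<phi> (x \<cdot>\<^bsub>P\<^esub> y) + \<mu> y (\<phi> x)" for x y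
  proof (rule inji)
    have "i (\<mu> y (\<phi> x)) = (s x - t x) \<cdot>\<^bsub>E\<^esub> t y"
      unfolding mu_section[OF t] i\<phi> by (rule E.mult_commute)
    then show "i (h x y - h' x y) = i (\<mu> x (\<phi> y) - \<phi> (x \<cdot>\<^bsub>P\<^esub> y) + \<mu> y (\<phi> x))"
      by (simp add: il hH mu_section[OF s, of x] i\<phi> bl)
  qed
  have D: "H x y - H' x y = \<rho> x (\<phi> y) - \<phi> \<lbrace>x, y\<rbrace>\<^bsub>P\<^esub> - \<rho> y (\<phi> x)" for x y
  proof (rule inji)
    have "i (\<rho> y (\<phi> x)) = - \<lbrace>s x - t x, t y\<rbrace>\<^bsub>E\<^esub>"
      unfolding rho_section[OF t] i\<phi> by (rule E.bracket_skew)
    then show "i (H x y - H' x y) = i (\<rho> x (\<phi> y) - \<phi> \<lbrace>x, y\<rbrace>\<^bsub>P\<^esub> - \<rho> y (\<phi> x))"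
      by (simp add: il hH rho_section[OF s, of x] i\<phi> bl)
  qed
  define \<psi> where "\<psi> = (\<lambda>x. \<beta> (\<phi> (?a x)) - \<phi> x)"
  have \<psi>l: "Vector_Spaces.linear (smult P) sV \<psi>"
    unfolding Vector_Spaces.linear_iff \<psi>_def
    by (intro conjI allI vector_space_axioms V.vector_space_axioms)
      (simp_all add: ia b linearD[OF \<phi>l] V.scale_right_diff_distrib)
  let ?C = "twist ba (section_cocycle P E i s) - section_cocycle P E i s"
  let ?D = "twist ba (section_cocycle P E i t) - section_cocycle P E i t"
  have Z: "?C \<in> cocycles2 P sV \<mu> \<rho>" "?D \<in> cocycles2 P sV \<mu> \<rho>"
    by (intro cocycles2_diff twist_in section_cocycle_in s t ba)+
  have bd: "\<beta> (h (?a x) (?a y)) - \<beta> (h' (?a x) (?a y)) =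
      \<mu> x (\<beta> (\<phi> (?a y))) - \<beta> (\<phi> (?a (x \<cdot>\<^bsub>P\<^esub> y))) + \<mu> y (\<beta> (\<phi> (?a x)))" for x y
    using arg_cong[OF d[of "?a x" "?a y"], of \<beta>] by (simp add: b bm aa ia)
  have bD: "\<beta> (H (?a x) (?a y)) - \<beta> (H' (?a x) (?a y)) =
      \<rho> x (\<beta> (\<phi> (?a y))) - \<beta> (\<phi> (?a \<lbrace>x, y\<rbrace>\<^bsub>P\<^esub>)) - \<rho> y (\<beta> (\<phi> (?a x)))" for x y
    using arg_cong[OF D[of "?a x" "?a y"], of \<beta>] by (simp add: b br aa ia)
  have "(\<beta> (h (?a x) (?a y)) - h x y) - (\<beta> (h' (?a x) (?a y)) - h' x y) =
      \<mu> x (\<psi> y) - \<psi> (x \<cdot>\<^bsub>P\<^esub> y) + \<mu> y (\<psi> x)" for x y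
    using arg_cong2[OF bd[of x y] d[of x y], of minus] by (simp add: \<psi>_def bl algebra_simps)
  moreover have "(\<beta> (H (?a x) (?a y)) - H x y) - (\<beta> (H' (?a x) (?a y)) - H' x y) =
      \<rho> x (\<psi> y) - \<psi> \<lbrace>x, y\<rbrace>\<^bsub>P\<^esub> - \<rho> y (\<psi> x)" for x y
    using arg_cong2[OF bD[of x y] D[of x y], of minus] by (simp add: \<psi>_def bl algebra_simps)
  ultimately have "(?C, ?D) \<in> cohomologous P sV \<mu> \<rho>"
    using Z \<psi>l unfolding cohomologous_def c c' ba' twist_def by auto
  then show ?thesis
    unfolding wells_wrt_def cohomology_class_def by (rule equiv_class_eq[OF equiv_cohomologous])
qed

lemma wells_map_eq:
  assumes "s \<in> linear_sections P E p" "ba \<in> compatible_pairs P sV \<mu> \<rho>"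
  shows "wells_map P sV \<mu> \<rho> E i p ba = wells_wrt P sV \<mu> \<rho> E i s ba"
  unfolding wells_map_def
  by (rule wells_wrt_cong[OF someI[of "\<lambda>t. t \<in> linear_sections P E p", OF assms(1)] assms])

end

end

(* Fix a linear section s with cocycle (h, H).  Every element of E is s x + i v for unique x, v, and
   a linear \<gamma> on E which restricts to \<beta> and induces \<alpha> must have the form
     \<gamma> (s x + i v) = s (\<alpha> x) + i (\<beta> v + \<lambda> x)
   for a linear \<lambda> from P to V.  Comparing V-components, \<gamma> preserves products and brackets iff
   (\<beta>, \<alpha>) is compatible and \<lambda> \<circ> \<alpha>\<inverse> exhibits twist (\<beta>, \<alpha>) (h, H) - (h, H) as a coboundary. *)
theory Submission
  imports Defs
begin

section \<open>Homomorphisms, automorphisms and linear inverses\<close>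

lemma poisson_homD:
  assumes "f \<in> poisson_hom A B"
  shows "Vector_Spaces.linear (smult A) (smult B) f" "f (x \<cdot>\<^bsub>A\<^esub> y) = f x \<cdot>\<^bsub>B\<^esub> f y"
    "f \<lbrace>x, y\<rbrace>\<^bsub>A\<^esub> = \<lbrace>f x, f y\<rbrace>\<^bsub>B\<^esub>"
  using assms by (simp_all add: poisson_hom_def)

lemma poisson_autD:
  assumes "f \<in> poisson_aut A"
  shows "f \<in> poisson_hom A A" "bij f"
  using assms by (simp_all add: poisson_aut_def)

lemma linear_inv:
  assumes "Vector_Spaces.linear s s f" "bij f"
  shows "Vector_Spaces.linear s s (inv f)"
proof -
  interpret Vector_Spaces.linear s s f by (rule assms)
  have "inv f x = y \<longleftrightarrow> x = f y" for x y
    using bij_inv_eq_iff[OF assms(2), of y x] by auto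
  then show ?thesis
    unfolding Vector_Spaces.linear_iff
    by (simp add: vs1.vector_space_axioms add scale bij_is_surj[OF assms(2)] surj_f_inv_f)
qed

context abelian_extension
begin

section \<open>Coordinates on \<open>E\<close> given by a linear section\<close>

lemma p_i: "p (i v) = 0"
  using exact by blast

text \<open>\<open>p\<close> kills \<open>e - s (p e)\<close>, so exactness places this difference
  in the range of \<open>i\<close>.\<close>

lemma section_decomp:
  assumes s: "s \<in> linear_sections P E p"
  obtains v where "e = s (p e) + i v"
proof
  show "e = s (p e) + i (inv i (e - s (p e)))"
    by (subst i_inv) (simp_all add: linearD[OF p_linear] section_p[OF s])
qed

text \<open>Expand bilinearly: \<open>h\<close> records how far \<open>s\<close> is from being
  multiplicative, the mixed terms are the action \<open>\<mu>\<close>, and \<open>i v\<close> times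
  \<open>i w\<close> vanishes since V carries the zero product.\<close>

lemma section_mult:
  assumes s: "s \<in> linear_sections P E p" and c: "section_cocycle P E i s = (h, H)"
  shows "(s x + i v) \<cdot>\<^bsub>E\<^esub> (s y + i w) = s (x \<cdot>\<^bsub>P\<^esub> y) + i (h x y + \<mu> x w + \<mu> y v)"
  by (simp add: bl linearD[OF i_linear] i_section_cocycle[OF s c] mu_section[OF s] i_zero_ops
      E.mult_commute[of "i v" "s y"])

text \<open>The same expansion for the bracket; skew symmetry turns the bracket of
  \<open>i v\<close> with \<open>s y\<close> into minus the action of \<open>y\<close> on
  \<open>v\<close>.\<close>

lemma section_bracket:
  assumes s: "s \<in> linear_sections P E p" and c: "section_cocycle P E i s = (h, H)"
  shows "\<lbrace>s x + i v, s y + i w\<rbrace>\<^bsub>E\<^esub> = s \<lbrace>x, y\<rbrace>\<^bsub>P\<^esub> + i (H x y + \<rho> x w - \<rho> y v)"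
  by (simp add: bl linearD[OF i_linear] i_section_cocycle[OF s c] rho_section[OF s] i_zero_ops
      E.bracket_skew[of "i v" "s y"])

section \<open>Vanishing of the Wells class\<close>

text \<open>Evaluating the coboundary equations at \<open>\<alpha> x\<close> and
  \<open>\<alpha> y\<close> removes the inverse of \<open>\<alpha>\<close> from the twisted cocycle.
  A primitive \<open>\<phi>\<close> then corresponds to \<open>l = \<phi> \<circ> \<alpha>\<close>,
  the shape in which the V-component of a lift appears.\<close>

lemma wells_map_zero_iff:
  assumes ba: "(\<beta>, \<alpha>) \<in> compatible_pairs P sV \<mu> \<rho>"
    and s: "s \<in> linear_sections P E p" and c: "section_cocycle P E i s = (h, H)"
  shows "wells_map P sV \<mu> \<rho> E i p (\<beta>, \<alpha>) = H2_zero P sV \<mu> \<rho> \<longleftrightarrow>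
    (\<exists>l. Vector_Spaces.linear (smult P) sV l \<and>
      (\<forall>x y. \<beta> (h x y) - h (\<alpha> x) (\<alpha> y) = \<mu> (\<alpha> x) (l y) - l (x \<cdot>\<^bsub>P\<^esub> y) + \<mu> (\<alpha> y) (l x)) \<and>
      (\<forall>x y. \<beta> (H x y) - H (\<alpha> x) (\<alpha> y) = \<rho> (\<alpha> x) (l y) - l \<lbrace>x, y\<rbrace>\<^bsub>P\<^esub> - \<rho> (\<alpha> y) (l x)))"
    (is "_ \<longleftrightarrow> (\<exists>l. ?lin l \<and> ?mult l \<and> ?brac l)")
proof -
  let ?a = "inv \<alpha>"
  have aut: "\<alpha> \<in> poisson_aut P"
    using ba by (simp add: compatible_pairs_def)
  note al = poisson_homD[OF poisson_autD(1)[OF aut]] and abij = poisson_autD(2)[OF aut]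
  have aa: "\<alpha> (?a x) = x" "?a (\<alpha> x) = x" for x
    using abij by (simp_all add: bij_is_surj surj_f_inv_f bij_is_inj)
  let ?C = "twist (\<beta>, \<alpha>) (h, H) - (h, H)"
  have C: "?C \<in> cocycles2 P sV \<mu> \<rho>"
    unfolding c[symmetric] by (intro cocycles2_diff twist_in section_cocycle_in s ba)
  \<comment> \<open>Two cocycles have equal classes exactly when they are related; here the second
    one is 0.\<close>
  have "wells_map P sV \<mu> \<rho> E i p (\<beta>, \<alpha>) = H2_zero P sV \<mu> \<rho> \<longleftrightarrow> (?C, 0) \<in> cohomologous P sV \<mu> \<rho>"
    unfolding wells_map_eq[OF s ba] wells_wrt_def c H2_zero_def cohomology_class_def
    by (rule eq_equiv_class_iff[OF equiv_cohomologous C zero_cocycle])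
  also have "\<dots> \<longleftrightarrow> (\<exists>\<phi>. ?lin \<phi> \<and>
      (\<forall>x y. \<beta> (h (?a x) (?a y)) - h x y = \<mu> x (\<phi> y) - \<phi> (x \<cdot>\<^bsub>P\<^esub> y) + \<mu> y (\<phi> x)) \<and>
      (\<forall>x y. \<beta> (H (?a x) (?a y)) - H x y = \<rho> x (\<phi> y) - \<phi> \<lbrace>x, y\<rbrace>\<^bsub>P\<^esub> - \<rho> y (\<phi> x)))"
    (is "_ \<longleftrightarrow> (\<exists>\<phi>. ?lin \<phi> \<and> ?mult' \<phi> \<and> ?brac' \<phi>)")
    using C zero_cocycle by (simp add: cohomologous_def twist_def zero_prod_def)
  also have "\<dots> \<longleftrightarrow> (\<exists>l. ?lin l \<and> ?mult l \<and> ?brac l)"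
  proof
    assume "\<exists>\<phi>. ?lin \<phi> \<and> ?mult' \<phi> \<and> ?brac' \<phi>"
    then obtain \<phi> where f: "?lin \<phi>" "?mult' \<phi>" "?brac' \<phi>" by blast
    have "?lin (\<phi> \<circ> \<alpha>)" by (rule Vector_Spaces.linear_compose[OF al(1) f(1)])
    moreover have "?mult (\<phi> \<circ> \<alpha>)"
      using f(2)[rule_format, of "\<alpha> _" "\<alpha> _"] by (simp add: aa al(2))
    moreover have "?brac (\<phi> \<circ> \<alpha>)"
      using f(3)[rule_format, of "\<alpha> _" "\<alpha> _"] by (simp add: aa al(3))
    ultimately show "\<exists>l. ?lin l \<and> ?mult l \<and> ?brac l" by blast
  next
    assume "\<exists>l. ?lin l \<and> ?mult l \<and> ?brac l"
    then obtain l where l: "?lin l" "?mult l" "?brac l" by blast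
    have inv: "?a (x \<cdot>\<^bsub>P\<^esub> y) = ?a x \<cdot>\<^bsub>P\<^esub> ?a y" "?a \<lbrace>x, y\<rbrace>\<^bsub>P\<^esub> = \<lbrace>?a x, ?a y\<rbrace>\<^bsub>P\<^esub>" for x y
      by (metis aa al(2)) (metis aa al(3))
    have "?lin (l \<circ> ?a)" by (rule Vector_Spaces.linear_compose[OF linear_inv[OF al(1) abij] l(1)])
    moreover have "?mult' (l \<circ> ?a)"
      using l(2)[rule_format, of "?a _" "?a _"] by (simp add: aa inv)
    moreover have "?brac' (l \<circ> ?a)"
      using l(3)[rule_format, of "?a _" "?a _"] by (simp add: aa inv)
    ultimately show "\<exists>\<phi>. ?lin \<phi> \<and> ?mult' \<phi> \<and> ?brac' \<phi>" by blast
  qed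
  finally show ?thesis .
qed

section \<open>A lift yields compatibility and a primitive\<close>

lemma inducible_imp:
  assumes aut: "\<beta> \<in> poisson_aut (trivial_poisson sV)" "\<alpha> \<in> poisson_aut P"
    and ind: "inducible P E i p (\<beta>, \<alpha>)"
  shows "(\<beta>, \<alpha>) \<in> compatible_pairs P sV \<mu> \<rho>"
    and "wells_map P sV \<mu> \<rho> E i p (\<beta>, \<alpha>) = H2_zero P sV \<mu> \<rho>"
proof -
  obtain s where s: "s \<in> linear_sections P E p"
    using linear_sections_nonempty by blast
  obtain h H where c: "section_cocycle P E i s = (h, H)" by fastforce
  obtain \<gamma> where \<gamma>: "\<gamma> \<in> poisson_aut E" and \<gamma>i: "\<gamma> (i v) = i (\<beta> v)"
    and \<gamma>s: "p \<circ> \<gamma> \<circ> s = \<alpha>" for v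
    using ind unfolding inducible_iff_section[OF s] by blast
  note hom = poisson_homD[OF poisson_autD(1)[OF \<gamma>]]
  note al = poisson_homD[OF poisson_autD(1)[OF aut(2)]]
  note gl = linearD[OF hom(1)] and il = linearD[OF i_linear] and inji = injD[OF i_inj]
    and sl = linearD[OF section_linear[OF s]]
  \<comment> \<open>\<open>\<gamma> (s x)\<close> and \<open>s (\<alpha> x)\<close> both lie over
    \<open>\<alpha> x\<close>, so their difference comes from V.\<close>
  define l where "l x = inv i (\<gamma> (s x) - s (\<alpha> x))" for x
  have il': "i (l x) = \<gamma> (s x) - s (\<alpha> x)" for x
    unfolding l_def using fun_cong[OF \<gamma>s, of x]
    by (intro i_inv) (simp add: linearD[OF p_linear] section_p[OF s])
  have form: "\<gamma> (s x + i v) = s (\<alpha> x) + i (\<beta> v + l x)" for x v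
    by (simp add: gl il il' \<gamma>i)
  have form0: "\<gamma> (s x) = s (\<alpha> x) + i (l x)" for x
    by (simp add: il')
  \<comment> \<open>Apply \<open>\<gamma>\<close> to the product of \<open>s x\<close> and
    \<open>i v\<close>: the correction \<open>i (l x)\<close> meets only elements of the image of V
    and drops out. The bracket case is alike.\<close>
  have "\<beta> (\<mu> x v) = \<mu> (\<alpha> x) (\<beta> v)" for x v
  proof (rule inji)
    have "i (\<beta> (\<mu> x v)) = \<gamma> (s x \<cdot>\<^bsub>E\<^esub> i v)"
      by (simp add: \<gamma>i flip: mu_section[OF s])
    then show "i (\<beta> (\<mu> x v)) = i (\<mu> (\<alpha> x) (\<beta> v))"
      by (simp add: mu_section[OF s] hom(2) form0 \<gamma>i bl i_zero_ops)
  qed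
  moreover have "\<beta> (\<rho> x v) = \<rho> (\<alpha> x) (\<beta> v)" for x v
  proof (rule inji)
    have "i (\<beta> (\<rho> x v)) = \<gamma> (\<lbrace>s x, i v\<rbrace>\<^bsub>E\<^esub>)"
      by (simp add: \<gamma>i flip: rho_section[OF s])
    then show "i (\<beta> (\<rho> x v)) = i (\<rho> (\<alpha> x) (\<beta> v))"
      by (simp add: rho_section[OF s] hom(3) form0 \<gamma>i bl i_zero_ops)
  qed
  ultimately show cp: "(\<beta>, \<alpha>) \<in> compatible_pairs P sV \<mu> \<rho>"
    using aut by (simp add: compatible_pairs_def)
  have "Vector_Spaces.linear (smult P) sV l"
    unfolding Vector_Spaces.linear_iff
    by (intro conjI allI vector_space_axioms V.vector_space_axioms inji)
      (simp_all add: il' il sl gl linearD[OF al(1)] E.scale_right_diff_distrib)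
  moreover have "\<beta> (h x y) - h (\<alpha> x) (\<alpha> y) = \<mu> (\<alpha> x) (l y) - l (x \<cdot>\<^bsub>P\<^esub> y) + \<mu> (\<alpha> y) (l x)" for x y
  proof -
    \<comment> \<open>Compute the image of the product of \<open>s x\<close> and \<open>s y\<close>
      in two ways. The \<open>s\<close> parts agree because \<open>\<alpha>\<close> is
      multiplicative, so injectivity of \<open>i\<close> compares the V-components.\<close>
    have "\<gamma> (s x \<cdot>\<^bsub>E\<^esub> s y) = (s (\<alpha> x) + i (l x)) \<cdot>\<^bsub>E\<^esub> (s (\<alpha> y) + i (l y))"
      by (simp add: hom(2) form0)
    moreover have "\<gamma> (s x \<cdot>\<^bsub>E\<^esub> s y) = s (\<alpha> (x \<cdot>\<^bsub>P\<^esub> y)) + i (\<beta> (h x y) + l (x \<cdot>\<^bsub>P\<^esub> y))"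
      using section_mult[OF s c, of x 0 y 0] form[of "x \<cdot>\<^bsub>P\<^esub> y" "h x y"] by (simp add: bl il)
    ultimately have "\<beta> (h x y) + l (x \<cdot>\<^bsub>P\<^esub> y) =
        h (\<alpha> x) (\<alpha> y) + \<mu> (\<alpha> x) (l y) + \<mu> (\<alpha> y) (l x)"
      by (intro inji) (simp add: section_mult[OF s c] al(2))
    then show ?thesis by (simp add: algebra_simps)
  qed
  moreover have "\<beta> (H x y) - H (\<alpha> x) (\<alpha> y) = \<rho> (\<alpha> x) (l y) - l \<lbrace>x, y\<rbrace>\<^bsub>P\<^esub> - \<rho> (\<alpha> y) (l x)" for x y
  proof -
    have "\<gamma> \<lbrace>s x, s y\<rbrace>\<^bsub>E\<^esub> = \<lbrace>s (\<alpha> x) + i (l x), s (\<alpha> y) + i (l y)\<rbrace>\<^bsub>E\<^esub>"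
      by (simp add: hom(3) form0)
    moreover have "\<gamma> \<lbrace>s x, s y\<rbrace>\<^bsub>E\<^esub> = s (\<alpha> \<lbrace>x, y\<rbrace>\<^bsub>P\<^esub>) + i (\<beta> (H x y) + l \<lbrace>x, y\<rbrace>\<^bsub>P\<^esub>)"
      using section_bracket[OF s c, of x 0 y 0] form[of "\<lbrace>x, y\<rbrace>\<^bsub>P\<^esub>" "H x y"] by (simp add: bl il)
    ultimately have "\<beta> (H x y) + l \<lbrace>x, y\<rbrace>\<^bsub>P\<^esub> =
        H (\<alpha> x) (\<alpha> y) + \<rho> (\<alpha> x) (l y) - \<rho> (\<alpha> y) (l x)"
      by (intro inji) (simp add: section_bracket[OF s c] al(3))
    then show ?thesis by (simp add: algebra_simps)
  qed
  ultimately show "wells_map P sV \<mu> \<rho> E i p (\<beta>, \<alpha>) = H2_zero P sV \<mu> \<rho>"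
    unfolding wells_map_zero_iff[OF cp s c] by blast
qed

section \<open>A primitive yields a lift\<close>

lemma inducible_if:
  assumes cp: "(\<beta>, \<alpha>) \<in> compatible_pairs P sV \<mu> \<rho>"
    and zero: "wells_map P sV \<mu> \<rho> E i p (\<beta>, \<alpha>) = H2_zero P sV \<mu> \<rho>"
  shows "inducible P E i p (\<beta>, \<alpha>)"
proof -
  obtain s where s: "s \<in> linear_sections P E p"
    using linear_sections_nonempty by blast
  obtain h H where c: "section_cocycle P E i s = (h, H)" by fastforce
  have aut: "\<beta> \<in> poisson_aut (trivial_poisson sV)" "\<alpha> \<in> poisson_aut P"
    and compat: "\<beta> (\<mu> x v) = \<mu> (\<alpha> x) (\<beta> v)" "\<beta> (\<rho> x v) = \<rho> (\<alpha> x) (\<beta> v)" for x v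
    using cp by (simp_all add: compatible_pairs_def)
  obtain l where l: "Vector_Spaces.linear (smult P) sV l"
    and lm: "\<beta> (h x y) - h (\<alpha> x) (\<alpha> y) = \<mu> (\<alpha> x) (l y) - l (x \<cdot>\<^bsub>P\<^esub> y) + \<mu> (\<alpha> y) (l x)"
    and lb: "\<beta> (H x y) - H (\<alpha> x) (\<alpha> y) = \<rho> (\<alpha> x) (l y) - l \<lbrace>x, y\<rbrace>\<^bsub>P\<^esub> - \<rho> (\<alpha> y) (l x)" for x y
    using zero unfolding wells_map_zero_iff[OF cp s c] by blast
  have lm': "\<beta> (h x y) = h (\<alpha> x) (\<alpha> y) + \<mu> (\<alpha> x) (l y) - l (x \<cdot>\<^bsub>P\<^esub> y) + \<mu> (\<alpha> y) (l x)" for x y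
    using lm[of x y] by (simp add: algebra_simps)
  have lb': "\<beta> (H x y) = H (\<alpha> x) (\<alpha> y) + \<rho> (\<alpha> x) (l y) - l \<lbrace>x, y\<rbrace>\<^bsub>P\<^esub> - \<rho> (\<alpha> y) (l x)" for x y
    using lb[of x y] by (simp add: algebra_simps)
  have bl1: "Vector_Spaces.linear sV sV \<beta>"
    using poisson_homD(1)[OF poisson_autD(1)[OF aut(1)]] by (simp add: trivial_poisson_def)
  note be = linearD[OF bl1] and bbij = poisson_autD(2)[OF aut(1)]
  note al = poisson_homD[OF poisson_autD(1)[OF aut(2)]] and abij = poisson_autD(2)[OF aut(2)]
  note il = linearD[OF i_linear] and inji = injD[OF i_inj] and pl = linearD[OF p_linear]
    and sl = linearD[OF section_linear[OF s]] and ll = linearD[OF l] and all = linearD[OF al(1)]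
  \<comment> \<open>\<open>p e\<close> and \<open>inv i (e - s (p e))\<close> are the two
    coordinates of \<open>e\<close>; the primitive \<open>l\<close> supplies the shear from P to
    V.\<close>
  define \<gamma> where "\<gamma> e = s (\<alpha> (p e)) + i (\<beta> (inv i (e - s (p e))) + l (p e))" for e
  have form: "\<gamma> (s x + i v) = s (\<alpha> x) + i (\<beta> v + l x)" for x v
    by (simp add: \<gamma>_def pl section_p[OF s] p_i inv_f_f[OF i_inj])
  have form0: "\<gamma> (s x) = s (\<alpha> x) + i (l x)" for x
    using form[of x 0] by (simp add: il be)
  have pform: "p (s x + i v) = x" for x v
    by (simp add: pl section_p[OF s] p_i)
  have "\<gamma> (a + b) = \<gamma> a + \<gamma> b" for a b
  proof -
    obtain v where a: "a = s (p a) + i v" by (rule section_decomp[OF s])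
    obtain w where b: "b = s (p b) + i w" by (rule section_decomp[OF s])
    \<comment> \<open>Regroups the sum into the shape on which \<open>form\<close> can
      rewrite.\<close>
    have "s (p a) + i v + (s (p b) + i w) = s (p a + p b) + i (v + w)"
      by (simp add: sl il)
    then have "\<gamma> (s (p a) + i v + (s (p b) + i w)) = \<gamma> (s (p a) + i v) + \<gamma> (s (p b) + i w)"
      by (simp only: form) (simp add: sl il all be ll)
    then show ?thesis using a b by simp
  qed
  moreover have "\<gamma> (smult E k a) = smult E k (\<gamma> a)" for k a
  proof -
    obtain v where a: "a = s (p a) + i v" by (rule section_decomp[OF s])
    have "smult E k (s (p a) + i v) = s (smult P k (p a)) + i (sV k v)"
      by (simp add: sl il E.scale_right_distrib)
    then have "\<gamma> (smult E k (s (p a) + i v)) = smult E k (\<gamma> (s (p a) + i v))"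
      by (simp only: form) (simp add: sl il all be ll E.scale_right_distrib)
    then show ?thesis using a by simp
  qed
  ultimately have "Vector_Spaces.linear (smult E) (smult E) \<gamma>"
    unfolding Vector_Spaces.linear_iff using E.vector_space_axioms by blast
  moreover have "\<gamma> (a \<cdot>\<^bsub>E\<^esub> b) = \<gamma> a \<cdot>\<^bsub>E\<^esub> \<gamma> b" for a b
  proof -
    obtain v where a: "a = s (p a) + i v" by (rule section_decomp[OF s])
    obtain w where b: "b = s (p b) + i w" by (rule section_decomp[OF s])
    \<comment> \<open>In coordinates, \<open>compat\<close> matches the terms in which P acts on
      \<open>v\<close> or \<open>w\<close>, and \<open>lm'\<close> matches the remaining term in
      \<open>h\<close>.\<close>
    have "\<gamma> ((s (p a) + i v) \<cdot>\<^bsub>E\<^esub> (s (p b) + i w)) = \<gamma> (s (p a) + i v) \<cdot>\<^bsub>E\<^esub> \<gamma> (s (p b) + i w)"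
      unfolding section_mult[OF s c] form
      by (simp add: be compat lm' al(2) bl il algebra_simps)
    then show ?thesis using a b by simp
  qed
  moreover have "\<gamma> \<lbrace>a, b\<rbrace>\<^bsub>E\<^esub> = \<lbrace>\<gamma> a, \<gamma> b\<rbrace>\<^bsub>E\<^esub>" for a b
  proof -
    obtain v where a: "a = s (p a) + i v" by (rule section_decomp[OF s])
    obtain w where b: "b = s (p b) + i w" by (rule section_decomp[OF s])
    have "\<gamma> \<lbrace>s (p a) + i v, s (p b) + i w\<rbrace>\<^bsub>E\<^esub> = \<lbrace>\<gamma> (s (p a) + i v), \<gamma> (s (p b) + i w)\<rbrace>\<^bsub>E\<^esub>"
      unfolding section_bracket[OF s c] form
      by (simp add: be compat lb' al(3) bl il algebra_simps)
    then show ?thesis using a b by simp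
  qed
  ultimately have hom: "\<gamma> \<in> poisson_hom E E"
    by (simp add: poisson_hom_def)
  have "inj \<gamma>"
  proof (rule injI)
    fix a b assume eq: "\<gamma> a = \<gamma> b"
    obtain v where a: "a = s (p a) + i v" by (rule section_decomp[OF s])
    obtain w where b: "b = s (p b) + i w" by (rule section_decomp[OF s])
    have eq': "s (\<alpha> (p a)) + i (\<beta> v + l (p a)) = s (\<alpha> (p b)) + i (\<beta> w + l (p b))"
      using eq a b form by metis
    \<comment> \<open>Applying \<open>p\<close> to \<open>eq'\<close> leaves
      \<open>\<alpha> (p a) = \<alpha> (p b)\<close>.\<close>
    then have pab: "p a = p b"
      using pform bij_is_inj[OF abij] by (metis injD)
    then have "\<beta> v = \<beta> w"
      using eq' by (simp add: inj_eq[OF i_inj])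
    then have "v = w"
      using bij_is_inj[OF bbij] by (simp add: injD)
    then show "a = b" using a b pab by simp
  qed
  moreover have "surj \<gamma>"
  proof (rule surjI)
    fix e
    \<comment> \<open>The preimage solves \<open>form\<close> for its two coordinates: invert
      \<open>\<alpha>\<close> first, then subtract the resulting value of \<open>l\<close> before
      inverting \<open>\<beta>\<close>.\<close>
    show "\<gamma> (s (inv \<alpha> (p e)) + i (inv \<beta> (inv i (e - s (p e)) - l (inv \<alpha> (p e))))) = e"
      unfolding form
      by (simp add: surj_f_inv_f[OF bij_is_surj[OF abij]] surj_f_inv_f[OF bij_is_surj[OF bbij]]
          i_inv pl section_p[OF s])
  qed
  ultimately have "\<gamma> \<in> poisson_aut E"
    using hom by (simp add: poisson_aut_def bij_def)
  moreover have \<gamma>i: "\<gamma> (i v) = i (\<beta> v)" for v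
    using form[of 0 v] by (simp add: sl all ll)
  moreover have "p \<circ> \<gamma> \<circ> s = \<alpha>"
    by (simp add: fun_eq_iff form0 pform)
  \<comment> \<open>One section suffices, and invariance of the range of \<open>i\<close> follows
    from \<open>\<gamma>i\<close>.\<close>
  ultimately show ?thesis
    unfolding inducible_iff_section[OF s] by (auto intro!: bexI[of _ \<gamma>])
qed

end

theorem theorem3p3:
  fixes P :: "('k::field_char_0, 'p::ab_group_add) poisson"
    and sV :: "'k \<Rightarrow> 'v::ab_group_add \<Rightarrow> 'v"
    and \<mu> \<rho> :: "'p \<Rightarrow> 'v \<Rightarrow> 'v"
    and E :: "('k, 'e::ab_group_add) poisson"
    and i :: "'v \<Rightarrow> 'e" and p :: "'e \<Rightarrow> 'p"
    and \<beta> :: "'v \<Rightarrow> 'v" and \<alpha> :: "'p \<Rightarrow> 'p"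
  assumes "poisson_algebra P"
    and "poisson_rep P sV \<mu> \<rho>"
    and "abelian_extension P sV \<mu> \<rho> E i p"
    and "(\<beta>, \<alpha>) \<in> poisson_aut (trivial_poisson sV) \<times> poisson_aut P"
  shows "inducible P E i p (\<beta>, \<alpha>) \<longleftrightarrow>
    (\<beta>, \<alpha>) \<in> compatible_pairs P sV \<mu> \<rho> \<and>
    wells_map P sV \<mu> \<rho> E i p (\<beta>, \<alpha>) = H2_zero P sV \<mu> \<rho>"
proof -
  interpret abelian_extension P sV \<mu> \<rho> E i p by (rule assms(3))
  show ?thesis
    using assms(4) inducible_imp inducible_if by blast
qed

end
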